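(* Every $\text{PCTL}_{\mathit{live}}^{<}$-formula is a liveness property.
   Context: Fix a finite non-empty set $\mathit{AP}$. A probabilistic tree (PT) is $T=(W,L,P)$ with $\epsilon\notin W$, $W\cup\{\epsilon\}\subseteq\mathbb{N}^*$ prefix-closed, $L:W\to\mathcal{P}(\mathit{AP})$, and $P$ a partial function from $W$ to distributions over $W$ with $P(\pi)(\pi')>0$ iff $\pi'=\pi\cdot n\in W$ for some $n$. $T$ is total if every node is a proper prefix of some node; finite-depth if node lengths are bounded. $\mathbb{T}^\omega$, $\mathbb{T}^*$: sets of total, finite-depth PTs. For $T_1\in\mathbb{T}^*$, $T_1\preceq T_2$ iff $W_1\subseteq W_2$, $L_2|_{W_1}=L_1$ and $P_2|_{W_1\times W_1}=P_1$. A property $P\subseteq\mathbb{T}^\omega$ is a liveness property iff every $T_1\in\mathbb{T}^*$ has some $T_2\in P$ with $T_1\preceq T_2$. A Markov chain (MC) is $\mathsf{D}=(S,\mathit{AP},\to,L,s_0)$ with $S\subseteq\mathbb{N}$ countable, $\to:S\to\mathit{Dist}(S)$ total, $L:S\to\mathcal{P}(\mathit{AP})$, initial state $s_0$. Its unfolding $T(\mathsf{D})$ has as nodes the least set of state sequences containing $s_0$ and closed under appending a state $t$ with $\mu(t)>0$ where $\mathrm{last}(\pi)\to\mu$; labels $L(\mathrm{last}(\pi))$; edge probabilities $P(\pi,\pi')=\mu(\mathrm{last}(\pi'))$ with $\mathrm{last}(\pi)\to\mu$. PCTL: state formulas $\Phi::=a\mid\Phi_1\land\Phi_2\mid\neg\Phi\mid\mathbb{P}_{\bowtie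 q}(\varphi)$, path formulas $\varphi::=\mathsf{X}\Phi\mid\Phi_1\mathsf{U}\Phi_2\mid\Phi_1\mathsf{W}\Phi_2$, $\bowtie\in\{<,>,\le,\ge\}$, $q\in[0,1]$, standard semantics on MCs ($\pi\models\Phi_1\mathsf{W}\Phi_2$ iff $\pi\models\Phi_1\mathsf{U}\Phi_2$ or all states of $\pi$ satisfy $\Phi_1$); formulas in positive normal form; $\top=a\lor\neg a$, $\bot=\neg\top$, $\Diamond\Phi=\top\mathsf{U}\Phi$. $P_\Phi=\{T(\mathsf{D})\mid\mathsf{D}\models\Phi\}$ ($\mathsf{D}\models\Phi$ iff the initial state satisfies $\Phi$); $\Phi$ is a liveness property iff $P_\Phi$ is; $\Phi\equiv\Psi$ iff $P_\Phi=P_\Psi$. Literal formulas: $\Phi^a::=a\mid\neg\Phi^a\mid\Phi^a_1\land\Phi^a_2$. $\text{PCTL}_{\mathit{live}}^{<}$ is the smallest set $\mathcal{F}$ of PCTL formulas such that: (1) $\top\in\mathcal{F}$ and $\bot\notin\mathcal{F}$ (no formula equivalent to $\bot$ belongs to $\mathcal{F}$); (2) $\mathbb{P}_{\ge q}(\Diamond\Phi^a)\in\mathcal{F}$ for every literal formula $\Phi^a$; (3) if $\Phi_1,\Phi_2\in\mathcal{F}$ then $\Phi_1\land\Phi_2\in\mathcal{F}$; (4) if $\Phi_1\in\mathcal{F}$ or $\Phi_2\in\mathcal{F}$ then $\Phi_1\lor\Phi_2$, $\mathbb{P}_{\ge q}(\Phi_1\mathsf{W}\Phi_2)\in\mathcal{F}$;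 (5) if $\Phi\in\mathcal{F}$ then $\mathbb{P}_{\ge q}(\mathsf{X}\Phi)\in\mathcal{F}$; (6) if $\Phi_2\in\mathcal{F}$ then $\mathbb{P}_{\ge q}(\Phi_1\mathsf{U}\Phi_2)\in\mathcal{F}$ for any $\Phi_1$.
   Formalization: P_Φ is taken up to isomorphism of PTs and a PT has at most one node of length 1 (otherwise no P_Φ is live); "no formula equivalent to ⊥ in F" is read as a side condition on every rule, since rule (2) yields P≥1(◇(a∧¬a)). *)

theory Defs
  imports "HOL-Probability.Probability" "HOL-Library.Sublist"
begin

section \<open>Probabilistic trees\<close>

text \<open>
  The finite non-empty set of atomic propositions is the type variable \<open>'ap\<close> (of class
  \<open>finite\<close> in the theorem). A partial map \<open>W \<rightharpoonup> Dist(W)\<close> is an option-valued function.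
\<close>

record 'ap pt =
  nodes :: "nat list set"
  lab :: "nat list \<Rightarrow> 'ap set"
  sdist :: "nat list \<Rightarrow> nat list pmf option"

definition edge_prob :: "'ap pt \<Rightarrow> nat list \<Rightarrow> nat list \<Rightarrow> real" where
  "edge_prob T \<pi> \<pi>' = (case sdist T \<pi> of None \<Rightarrow> 0 | Some \<mu> \<Rightarrow> pmf \<mu> \<pi>')"

text \<open>
  The third conjunct says that a tree has at most one root: as \<open>[]\<close> is not a node, the
  nodes of length one are the roots. It is needed since unfoldings of Markov chains have a single
  root and hence cannot extend a forest.
  The last conjunct forces \<open>sdist\<close> to be undefined exactly at the leaves.
\<close>

definition is_pt :: "'ap pt \<Rightarrow> bool" where
  "is_pt T \<longleftrightarrow>
     [] \<notin> nodes T \<and>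
     (\<forall>\<pi>\<in>nodes T. \<forall>\<pi>'. prefix \<pi>' \<pi> \<longrightarrow> \<pi>' \<in> nodes T \<union> {[]}) \<and>
     (\<forall>m n. [m] \<in> nodes T \<longrightarrow> [n] \<in> nodes T \<longrightarrow> m = n) \<and>
     (\<forall>\<pi>. \<pi> \<notin> nodes T \<longrightarrow> sdist T \<pi> = None) \<and>
     (\<forall>\<pi>\<in>nodes T. \<forall>\<mu>. sdist T \<pi> = Some \<mu> \<longrightarrow> set_pmf \<mu> \<subseteq> nodes T) \<and>
     (\<forall>\<pi>\<in>nodes T. \<forall>\<pi>'. edge_prob T \<pi> \<pi>' > 0 \<longleftrightarrow> (\<exists>n. \<pi>' = \<pi> @ [n]) \<and> \<pi>' \<in> nodes T)"

definition total_pts :: "'ap pt set" where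
  "total_pts = {T. is_pt T \<and> (\<forall>\<pi>\<in>nodes T. \<exists>\<pi>'\<in>nodes T. strict_prefix \<pi> \<pi>')}"

definition finite_depth_pts :: "'ap pt set" where
  "finite_depth_pts = {T. is_pt T \<and> (\<exists>k. \<forall>\<pi>\<in>nodes T. length \<pi> \<le> k)}"

text \<open>
  The transition probabilities are compared as functions on \<open>nodes T\<^sub>1 \<times> nodes T\<^sub>1\<close>, undefined
  counting as 0: a leaf of \<open>T\<^sub>1\<close> may have successors in \<open>T\<^sub>2\<close>.
\<close>

definition pt_prefix :: "'ap pt \<Rightarrow> 'ap pt \<Rightarrow> bool" where
  "pt_prefix T\<^sub>1 T\<^sub>2 \<longleftrightarrow>
     nodes T\<^sub>1 \<subseteq> nodes T\<^sub>2 \<and>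
     (\<forall>\<pi>\<in>nodes T\<^sub>1. lab T\<^sub>2 \<pi> = lab T\<^sub>1 \<pi>) \<and>
     (\<forall>\<pi>\<in>nodes T\<^sub>1. \<forall>\<pi>'\<in>nodes T\<^sub>1. edge_prob T\<^sub>2 \<pi> \<pi>' = edge_prob T\<^sub>1 \<pi> \<pi>')"

definition liveness :: "'ap pt set \<Rightarrow> bool" where
  "liveness P \<longleftrightarrow> P \<subseteq> total_pts \<and> (\<forall>T\<^sub>1\<in>finite_depth_pts. \<exists>T\<^sub>2\<in>P. pt_prefix T\<^sub>1 T\<^sub>2)"

definition pt_iso :: "'ap pt \<Rightarrow> 'ap pt \<Rightarrow> bool" where
  "pt_iso T\<^sub>1 T\<^sub>2 \<longleftrightarrow> (\<exists>f. bij_betw f (nodes T\<^sub>1) (nodes T\<^sub>2) \<and>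
     (\<forall>\<pi>\<in>nodes T\<^sub>1. \<forall>\<pi>'\<in>nodes T\<^sub>1. prefix (f \<pi>) (f \<pi>') \<longleftrightarrow> prefix \<pi> \<pi>') \<and>
     (\<forall>\<pi>\<in>nodes T\<^sub>1. lab T\<^sub>2 (f \<pi>) = lab T\<^sub>1 \<pi>) \<and>
     (\<forall>\<pi>\<in>nodes T\<^sub>1. \<forall>\<pi>'\<in>nodes T\<^sub>1. edge_prob T\<^sub>2 (f \<pi>) (f \<pi>') = edge_prob T\<^sub>1 \<pi> \<pi>'))"


section \<open>Markov chains\<close>

record 'ap mc =
  states :: "nat set"
  trn :: "nat \<Rightarrow> nat pmf"
  slab :: "nat \<Rightarrow> 'ap set"
  init :: nat

definition is_mc :: "'ap mc \<Rightarrow> bool" where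
  "is_mc D \<longleftrightarrow> init D \<in> states D \<and> (\<forall>s\<in>states D. set_pmf (trn D s) \<subseteq> states D)"

inductive_set unfolding_nodes :: "'ap mc \<Rightarrow> nat list set" for D :: "'ap mc" where
  root: "[init D] \<in> unfolding_nodes D"
| step: "\<pi> \<in> unfolding_nodes D \<Longrightarrow> pmf (trn D (last \<pi>)) t > 0 \<Longrightarrow> \<pi> @ [t] \<in> unfolding_nodes D"

definition unfolding_pt :: "'ap mc \<Rightarrow> 'ap pt" where
  "unfolding_pt D = \<lparr>nodes = unfolding_nodes D, lab = (\<lambda>\<pi>. slab D (last \<pi>)),
     sdist = (\<lambda>\<pi>. if \<pi> \<in> unfolding_nodes D
       then Some (map_pmf (\<lambda>t. \<pi> @ [t]) (trn D (last \<pi>))) else None)\<rparr>"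

text \<open>
  The probability measure on infinite state sequences starting in \<open>s\<close> is the one given by the
  Ionescu-Tulcea theorem for the kernels ``first \<open>s\<close>, then one step of \<open>D\<close>''; it lives on the
  product \<open>\<sigma>\<close>-algebra, i.e. the one generated by the cylinder sets.
\<close>

definition path_kernel :: "'ap mc \<Rightarrow> nat \<Rightarrow> nat \<Rightarrow> (nat \<Rightarrow> nat) \<Rightarrow> nat measure" where
  "path_kernel D s n \<omega> =
     measure_pmf (case n of 0 \<Rightarrow> return_pmf s | Suc m \<Rightarrow> trn D (\<omega> m))"

lemma Ionescu_Tulcea_path_kernel:
  "Ionescu_Tulcea (path_kernel D s) (\<lambda>_. count_space UNIV)"
proof (rule Ionescu_Tulcea.intro)
  show "path_kernel D s i \<in> measurable (PiM {0..<i} (\<lambda>_. count_space UNIV))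
      (subprob_algebra (count_space UNIV))" for i
  proof (cases i)
    case 0
    then show ?thesis
      by (auto simp: path_kernel_def[abs_def] intro!: measurable_const measure_pmf_in_subprob_algebra)
  next
    case (Suc m)
    have "(\<lambda>\<omega>. \<omega> m) \<in> measurable (PiM {0..<Suc m} (\<lambda>_. count_space UNIV)) (count_space (UNIV::nat set))"
      by (rule measurable_component_singleton) simp
    then have "(\<lambda>\<omega>. measure_pmf (trn D (\<omega> m))) \<in>
        measurable (PiM {0..<Suc m} (\<lambda>_. count_space UNIV)) (subprob_algebra (count_space UNIV))"
      by (rule measurable_compose[where g="\<lambda>s. measure_pmf (trn D s)"])
         (auto intro!: measure_pmf_in_subprob_algebra)
    with Suc show ?thesis
      by (simp add: path_kernel_def[abs_def])
  qed
qed (simp add: path_kernel_def prob_space_measure_pmf)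

definition path_measure :: "'ap mc \<Rightarrow> nat \<Rightarrow> (nat \<Rightarrow> nat) measure" where
  "path_measure D s = projective_family.lim UNIV
     (Ionescu_Tulcea.CI (path_kernel D s) (\<lambda>_. count_space UNIV)) (\<lambda>_. count_space UNIV)"

lemma emeasure_path_measure_cylinder:
  "emeasure (path_measure D s) {\<omega>. \<forall>i\<le>n. \<omega> i = x i} =
     (if x 0 = s then \<Prod>i<n. ennreal (pmf (trn D (x i)) (x (Suc i))) else 0)"
proof -
  interpret IT: Ionescu_Tulcea "path_kernel D s" "\<lambda>_. count_space UNIV"
    by (rule Ionescu_Tulcea_path_kernel)
  let ?M = "\<lambda>_::nat. count_space (UNIV::nat set)"
  let ?C = "\<lambda>n. IT.C 0 n (\<lambda>_. undefined)"
  let ?x = "\<lambda>n. {restrict x {0..<n}}"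
  have x_PiE: "?x n = PiE {0..<n} (\<lambda>i. {x i})" for n
    by (auto simp: PiE_iff extensional_def fun_eq_iff restrict_def)
  have x_sets[measurable]: "?x n \<in> sets (PiM {0..<n} ?M)" for n
    unfolding x_PiE by (rule sets_PiM_I_finite) auto
  have C: "emeasure (?C n) (?x n) = (\<Prod>i<n. emeasure (path_kernel D s i x) {x i})" for n
  proof (induction n)
    case 0
    then show ?case using x_sets[of 0] by (simp add: emeasure_return restrict_def)
  next
    case (Suc n)
    have "emeasure (?C (Suc n)) (?x (Suc n)) = (\<integral>\<^sup>+\<omega>. emeasure (IT.eP n \<omega>) (?x (Suc n)) \<partial>?C n)"
      by (simp, subst emeasure_bind[OF _ _ x_sets])
         (auto simp: IT.space_C space_PiM intro!: measurable_cong_sets[THEN equalityD1, THEN subsetD, OF IT.sets_C[symmetric] refl])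
    also have "\<dots> = (\<integral>\<^sup>+\<omega>. emeasure (path_kernel D s n x) {x n} * indicator (?x n) \<omega> \<partial>?C n)"
    proof (rule nn_integral_cong)
      fix \<omega> assume "\<omega> \<in> space (?C n)"
      then have w: "\<omega> \<in> space (PiM {0..<n} ?M)"
        by (simp add: IT.space_C space_PiM)
      have k: "\<omega> = restrict x {0..<n} \<Longrightarrow> path_kernel D s n \<omega> = path_kernel D s n x"
        by (cases n) (auto simp: path_kernel_def)
      have "fun_upd \<omega> n -` ?x (Suc n) = (if \<omega> = restrict x {0..<n} then {x n} else {})"
        using w by (auto simp: fun_eq_iff restrict_def space_PiM PiE_def extensional_def less_Suc_eq
              split: if_splits) (metis less_irrefl)
      then show "emeasure (IT.eP n \<omega>) (?x (Suc n)) = emeasure (path_kernel D s n x) {x n} * indicator (?x n) \<omega>"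
        using k by (subst IT.emeasure_eP[OF w x_sets]) (auto simp: indicator_def)
    qed
    also have "\<dots> = emeasure (path_kernel D s n x) {x n} * emeasure (?C n) (?x n)"
      using x_sets[of n] by (subst nn_integral_cmult_indicator) (auto simp: IT.sets_C space_PiM)
    also have "\<dots> = (\<Prod>i<Suc n. emeasure (path_kernel D s i x) {x i})"
      unfolding Suc by (simp add: mult.commute)
    finally show ?case .
  qed
  have "{\<omega>. \<forall>i\<le>n. \<omega> i = x i} = IT.PF.emb UNIV {0..<Suc n} (?x (Suc n))"
    by (auto simp: prod_emb_def fun_eq_iff restrict_def space_PiM less_Suc_eq_le split: if_split_asm)
  then have "emeasure (path_measure D s) {\<omega>. \<forall>i\<le>n. \<omega> i = x i} = emeasure (IT.CI {0..<Suc n}) (?x (Suc n))"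
    using IT.lim[OF _ x_sets[of "Suc n"]] by (simp add: path_measure_def)
  also have "\<dots> = emeasure (?C (Suc n)) (?x (Suc n))"
    by (subst IT.emeasure_CI[OF subset_refl x_sets]) (simp add: x_PiE)
  also have "\<dots> = (\<Prod>i<Suc n. emeasure (path_kernel D s i x) {x i})"
    by (rule C)
  also have "\<dots> = emeasure (path_kernel D s 0 x) {x 0} * (\<Prod>i<n. emeasure (path_kernel D s (Suc i) x) {x (Suc i)})"
    by (rule prod.lessThan_Suc_shift)
  also have "\<dots> = (if x 0 = s then \<Prod>i<n. ennreal (pmf (trn D (x i)) (x (Suc i))) else 0)"
    by (simp add: path_kernel_def emeasure_pmf_single)
  finally show ?thesis .
qed


section \<open>PCTL\<close>

datatype cmp = Less | Greater | LessEq | GreaterEq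

primrec cmp_rel :: "cmp \<Rightarrow> real \<Rightarrow> real \<Rightarrow> bool" where
  "cmp_rel Less x y \<longleftrightarrow> x < y"
| "cmp_rel Greater x y \<longleftrightarrow> x > y"
| "cmp_rel LessEq x y \<longleftrightarrow> x \<le> y"
| "cmp_rel GreaterEq x y \<longleftrightarrow> x \<ge> y"

datatype 'ap state_formula =
    Atom 'ap
  | And "'ap state_formula" "'ap state_formula"
  | Neg "'ap state_formula"
  | Prob cmp real "'ap path_formula"
and 'ap path_formula =
    Next "'ap state_formula"
  | Until "'ap state_formula" "'ap state_formula"
  | WeakUntil "'ap state_formula" "'ap state_formula"

text \<open>The PCTL formulas proper are those whose probability bounds all lie in \<open>[0,1]\<close>.\<close>

primrec pctl :: "'ap state_formula \<Rightarrow> bool" and pctl_path :: "'ap path_formula \<Rightarrow> bool" where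
  "pctl (Atom a) \<longleftrightarrow> True"
| "pctl (And \<Phi>\<^sub>1 \<Phi>\<^sub>2) \<longleftrightarrow> pctl \<Phi>\<^sub>1 \<and> pctl \<Phi>\<^sub>2"
| "pctl (Neg \<Phi>) \<longleftrightarrow> pctl \<Phi>"
| "pctl (Prob c q \<phi>) \<longleftrightarrow> 0 \<le> q \<and> q \<le> 1 \<and> pctl_path \<phi>"
| "pctl_path (Next \<Phi>) \<longleftrightarrow> pctl \<Phi>"
| "pctl_path (Until \<Phi>\<^sub>1 \<Phi>\<^sub>2) \<longleftrightarrow> pctl \<Phi>\<^sub>1 \<and> pctl \<Phi>\<^sub>2"
| "pctl_path (WeakUntil \<Phi>\<^sub>1 \<Phi>\<^sub>2) \<longleftrightarrow> pctl \<Phi>\<^sub>1 \<and> pctl \<Phi>\<^sub>2"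

primrec sat :: "'ap mc \<Rightarrow> 'ap state_formula \<Rightarrow> nat \<Rightarrow> bool"
  and path_sat :: "'ap mc \<Rightarrow> 'ap path_formula \<Rightarrow> (nat \<Rightarrow> nat) \<Rightarrow> bool" where
  "sat D (Atom a) s \<longleftrightarrow> a \<in> slab D s"
| "sat D (And \<Phi>\<^sub>1 \<Phi>\<^sub>2) s \<longleftrightarrow> sat D \<Phi>\<^sub>1 s \<and> sat D \<Phi>\<^sub>2 s"
| "sat D (Neg \<Phi>) s \<longleftrightarrow> \<not> sat D \<Phi> s"
| "sat D (Prob c q \<phi>) s \<longleftrightarrow> cmp_rel c (measure (path_measure D s) {\<omega>. path_sat D \<phi> \<omega>}) q"
| "path_sat D (Next \<Phi>) \<omega> \<longleftrightarrow> sat D \<Phi> (\<omega> 1)"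
| "path_sat D (Until \<Phi>\<^sub>1 \<Phi>\<^sub>2) \<omega> \<longleftrightarrow> (\<exists>j. sat D \<Phi>\<^sub>2 (\<omega> j) \<and> (\<forall>i<j. sat D \<Phi>\<^sub>1 (\<omega> i)))"
| "path_sat D (WeakUntil \<Phi>\<^sub>1 \<Phi>\<^sub>2) \<omega> \<longleftrightarrow>
     (\<exists>j. sat D \<Phi>\<^sub>2 (\<omega> j) \<and> (\<forall>i<j. sat D \<Phi>\<^sub>1 (\<omega> i))) \<or> (\<forall>i. sat D \<Phi>\<^sub>1 (\<omega> i))"

definition mc_sat :: "'ap mc \<Rightarrow> 'ap state_formula \<Rightarrow> bool" where
  "mc_sat D \<Phi> \<longleftrightarrow> sat D \<Phi> (init D)"

text \<open>
  Trees are identified up to isomorphism, i.e. up to renaming of nodes. Without this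
  identification no property would be live: a node of an unfolding is a sequence of states
  labelled by the label of its last state, so the finite-depth tree with nodes \<open>[0]\<close> and
  \<open>[0,0]\<close> carrying different labels is not a prefix of any unfolding.
\<close>

definition property_of :: "'ap state_formula \<Rightarrow> 'ap pt set" where
  "property_of \<Phi> = {T. is_pt T \<and> (\<exists>D. is_mc D \<and> mc_sat D \<Phi> \<and> pt_iso T (unfolding_pt D))}"

definition equivalent :: "'ap state_formula \<Rightarrow> 'ap state_formula \<Rightarrow> bool" where
  "equivalent \<Phi> \<Psi> \<longleftrightarrow> property_of \<Phi> = property_of \<Psi>"

definition Or :: "'ap state_formula \<Rightarrow> 'ap state_formula \<Rightarrow> 'ap state_formula" where
  "Or \<Phi>\<^sub>1 \<Phi>\<^sub>2 = Neg (And (Neg \<Phi>\<^sub>1) (Neg \<Phi>\<^sub>2))"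

text \<open>Truth and falsity are written with an atomic proposition \<open>a\<close>, whose choice is immaterial.\<close>

definition Top :: "'ap \<Rightarrow> 'ap state_formula" where
  "Top a = Or (Atom a) (Neg (Atom a))"

definition Bot :: "'ap \<Rightarrow> 'ap state_formula" where
  "Bot a = Neg (Top a)"

definition Eventually :: "'ap \<Rightarrow> 'ap state_formula \<Rightarrow> 'ap path_formula" where
  "Eventually a \<Phi> = Until (Top a) \<Phi>"

definition equiv_Bot :: "'ap state_formula \<Rightarrow> bool" where
  "equiv_Bot \<Phi> \<longleftrightarrow> (\<exists>a. equivalent \<Phi> (Bot a))"

inductive literal :: "'ap state_formula \<Rightarrow> bool" where
  "literal (Atom a)"
| "literal \<Phi> \<Longrightarrow> literal (Neg \<Phi>)"
| "literal \<Phi>\<^sub>1 \<Longrightarrow> literal \<Phi>\<^sub>2 \<Longrightarrow> literal (And \<Phi>\<^sub>1 \<Phi>\<^sub>2)"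

text \<open>
  The requirement that no formula equivalent to \<open>\<bottom>\<close> belongs to the fragment is a side condition
  of every rule. It cannot be imposed on the outcome of the unrestricted rules, since those
  produce for instance \<open>P\<^sub>\<ge>\<^sub>1(\<diamond>(a \<and> \<not>a))\<close>.
\<close>

inductive_set pctl_live :: "'ap state_formula set" where
  top: "Top a \<in> pctl_live"
| eventually:
    "literal \<Psi> \<Longrightarrow> 0 \<le> q \<Longrightarrow> q \<le> 1 \<Longrightarrow>
     \<not> equiv_Bot (Prob GreaterEq q (Eventually a \<Psi>)) \<Longrightarrow>
     Prob GreaterEq q (Eventually a \<Psi>) \<in> pctl_live"
| conj:
    "\<Phi>\<^sub>1 \<in> pctl_live \<Longrightarrow> \<Phi>\<^sub>2 \<in> pctl_live \<Longrightarrow> \<not> equiv_Bot (And \<Phi>\<^sub>1 \<Phi>\<^sub>2) \<Longrightarrow>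
     And \<Phi>\<^sub>1 \<Phi>\<^sub>2 \<in> pctl_live"
| disj:
    "pctl \<Phi>\<^sub>1 \<Longrightarrow> pctl \<Phi>\<^sub>2 \<Longrightarrow> \<Phi>\<^sub>1 \<in> pctl_live \<or> \<Phi>\<^sub>2 \<in> pctl_live \<Longrightarrow>
     \<not> equiv_Bot (Or \<Phi>\<^sub>1 \<Phi>\<^sub>2) \<Longrightarrow>
     Or \<Phi>\<^sub>1 \<Phi>\<^sub>2 \<in> pctl_live"
| weak_until:
    "pctl \<Phi>\<^sub>1 \<Longrightarrow> pctl \<Phi>\<^sub>2 \<Longrightarrow> \<Phi>\<^sub>1 \<in> pctl_live \<or> \<Phi>\<^sub>2 \<in> pctl_live \<Longrightarrow>
     0 \<le> q \<Longrightarrow> q \<le> 1 \<Longrightarrow> \<not> equiv_Bot (Prob GreaterEq q (WeakUntil \<Phi>\<^sub>1 \<Phi>\<^sub>2)) \<Longrightarrow>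
     Prob GreaterEq q (WeakUntil \<Phi>\<^sub>1 \<Phi>\<^sub>2) \<in> pctl_live"
| next_step:
    "\<Phi> \<in> pctl_live \<Longrightarrow> 0 \<le> q \<Longrightarrow> q \<le> 1 \<Longrightarrow>
     \<not> equiv_Bot (Prob GreaterEq q (Next \<Phi>)) \<Longrightarrow>
     Prob GreaterEq q (Next \<Phi>) \<in> pctl_live"
| until:
    "pctl \<Phi>\<^sub>1 \<Longrightarrow> \<Phi>\<^sub>2 \<in> pctl_live \<Longrightarrow> 0 \<le> q \<Longrightarrow> q \<le> 1 \<Longrightarrow>
     \<not> equiv_Bot (Prob GreaterEq q (Until \<Phi>\<^sub>1 \<Phi>\<^sub>2)) \<Longrightarrow>
     Prob GreaterEq q (Until \<Phi>\<^sub>1 \<Phi>\<^sub>2) \<in> pctl_live"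

end

theory Submission
  imports Defs
begin

text \<open>
  Extend a finite-depth tree by infinite non-branching chains below its leaves, whose labels depend
  on the depth only and run through every label infinitely often. In the resulting chain almost
  every path, from whatever state, visits every label. Hence every state satisfies
  every formula of the fragment: a formula \<open>P\<^sub>\<ge>\<^sub>q(\<diamond>\<Psi>)\<close> not equivalent to \<open>\<bottom>\<close> has \<open>q = 0\<close> or a
  \<open>\<Psi>\<close> that holds at some label, and the other rules preserve validity at all states.
\<close>

section \<open>The path measure\<close>

lemma sets_path_measure [measurable_cong]:
  "sets (path_measure D s) = sets (PiM UNIV (\<lambda>_. count_space UNIV))"
proof -
  interpret IT: Ionescu_Tulcea "path_kernel D s" "\<lambda>_. count_space UNIV"
    by (rule Ionescu_Tulcea_path_kernel)
  show ?thesis by (simp add: path_measure_def)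
qed

lemma space_path_measure [simp]: "space (path_measure D s) = UNIV"
  using sets_eq_imp_space_eq[OF sets_path_measure[of D s]] by (simp add: space_PiM)

text \<open>A push-forward keeps the total mass, and the image of the limit under restriction to the
  empty index set is a member of the projective family, hence a probability measure.\<close>

lemma prob_space_path_measure: "prob_space (path_measure D s)"
proof -
  interpret IT: Ionescu_Tulcea "path_kernel D s" "\<lambda>_. count_space UNIV"
    by (rule Ionescu_Tulcea_path_kernel)
  have "prob_space (distr IT.PF.lim (PiM {} (\<lambda>_. count_space UNIV)) (\<lambda>\<omega>. restrict \<omega> {}))"
    unfolding IT.distr_lim[OF finite.emptyI] by (rule IT.PF.prob_space_P) auto
  then show ?thesis
    unfolding path_measure_def
    by (rule prob_space_distrD[rotated])
      (simp add: measurable_cong_sets[OF IT.PF.sets_lim refl] measurable_restrict_subset)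
qed

lemma pred_path_coordinate [measurable]: "Measurable.pred (path_measure D s) (\<lambda>\<omega>. P (\<omega> i))"
proof -
  have "(\<lambda>\<omega>. \<omega> i) \<in> measurable (path_measure D s) (count_space UNIV)"
    by (subst measurable_cong_sets[OF sets_path_measure refl]) (rule measurable_component_singleton, simp)
  then show ?thesis
    by (rule measurable_compose) simp
qed

text \<open>For each step, the paths violating it lie in countably many cylinders, each null because
  its product formula contains a zero factor.\<close>

lemma AE_path_measure_transitions:
  "AE \<omega> in path_measure D s. \<forall>i. \<omega> (Suc i) \<in> set_pmf (trn D (\<omega> i))"
  unfolding AE_all_countable
proof
  fix i
  \<comment> \<open>Lists serve as indices because there are only countably many. Positions past the
    end of a short list still denote fixed numbers, so the cylinder formula applies to them
    too.\<close>
  let ?cyl = "\<lambda>xs. {\<omega>. \<forall>j\<le>Suc i. \<omega> j = xs ! j}"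
  let ?bad = "{xs. xs ! Suc i \<notin> set_pmf (trn D (xs ! i))}"
  have "(\<Union>xs\<in>?bad. ?cyl xs) \<in> null_sets (path_measure D s)"
  proof (rule null_sets_UN')
    fix xs :: "nat list" assume xs: "xs \<in> ?bad"
    have "Measurable.pred (path_measure D s) (\<lambda>\<omega>. \<forall>j\<le>Suc i. \<omega> j = xs ! j)"
      by (intro pred_intros_countable pred_intros_imp' pred_path_coordinate)
    then have "?cyl xs \<in> sets (path_measure D s)"
      by (simp add: pred_def)
    moreover have "(\<Prod>j<Suc i. ennreal (pmf (trn D (xs ! j)) (xs ! Suc j))) = 0"
      using xs by (auto simp: set_pmf_iff)
    ultimately show "?cyl xs \<in> null_sets (path_measure D s)"
      by (auto simp: null_sets_def emeasure_path_measure_cylinder)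
  qed auto
  then show "AE \<omega> in path_measure D s. \<omega> (Suc i) \<in> set_pmf (trn D (\<omega> i))"
  proof (rule AE_I')
    show "{\<omega> \<in> space (path_measure D s). \<omega> (Suc i) \<notin> set_pmf (trn D (\<omega> i))}
        \<subseteq> (\<Union>xs\<in>?bad. ?cyl xs)"
    proof
      fix \<omega> assume "\<omega> \<in> {\<omega> \<in> space (path_measure D s). \<omega> (Suc i) \<notin> set_pmf (trn D (\<omega> i))}"
      then show "\<omega> \<in> (\<Union>xs\<in>?bad. ?cyl xs)"
        by (intro UN_I[of "map \<omega> [0..<Suc (Suc i)]"]) (auto simp: nth_append less_Suc_eq_le simp del: upt_Suc)
    qed
  qed
qed

text \<open>A path formula is a countable Boolean combination of conditions on single coordinates,
  all measurable since the state space is discrete.\<close>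

lemma measurable_path_sat:
  "{\<omega>. path_sat D \<phi> \<omega>} \<in> sets (path_measure D s)"
proof -
  have "Measurable.pred (path_measure D s) (\<lambda>\<omega>. path_sat D \<phi> \<omega>)"
    by (cases \<phi>; simp only: path_sat.simps)
      (intro pred_intros_logic pred_intros_countable pred_intros_imp' pred_path_coordinate)+
  then show ?thesis by (simp add: pred_def)
qed

text \<open>Replaces probabilities by pointwise reasoning: what holds on all paths that follow the
  transitions has probability one, which meets every bound up to 1.\<close>

lemma sat_Prob_GreaterEqI:
  assumes "q \<le> 1"
    and "\<And>\<omega>. (\<And>i. \<omega> (Suc i) \<in> set_pmf (trn D (\<omega> i))) \<Longrightarrow> path_sat D \<phi> \<omega>"
  shows "sat D (Prob GreaterEq q \<phi>) s"
proof -
  interpret prob_space "path_measure D s" by (rule prob_space_path_measure)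
  have "AE \<omega> in path_measure D s. path_sat D \<phi> \<omega>"
    using AE_path_measure_transitions[of D s] assms(2) by (auto elim: eventually_mono)
  then have "prob {\<omega>. path_sat D \<phi> \<omega>} = 1"
    by (subst prob_eq_1) (auto simp: measurable_path_sat)
  then show ?thesis using assms(1) by simp
qed

section \<open>Satisfiability\<close>

lemma sat_Top [simp]: "sat D (Top a) s"
  by (simp add: Top_def Or_def)

lemma sat_Or [simp]: "sat D (Or \<Phi>\<^sub>1 \<Phi>\<^sub>2) s \<longleftrightarrow> sat D \<Phi>\<^sub>1 s \<or> sat D \<Phi>\<^sub>2 s"
  by (simp add: Or_def)

text \<open>Extracts a model from the side condition of the rules: no chain satisfies
  \<open>Bot a\<close>, so its property is empty.\<close>

lemma not_equiv_BotD:
  assumes "\<not> equiv_Bot \<Phi>"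
  obtains D where "is_mc D" "sat D \<Phi> (init D)"
proof -
  have "property_of (Bot a) = {}" for a :: 'a
    by (auto simp: property_of_def mc_sat_def Bot_def)
  with assms have "property_of \<Phi> \<noteq> {}"
    by (simp add: equiv_Bot_def equivalent_def)
  then show ?thesis
    using that by (auto simp: property_of_def mc_sat_def)
qed

lemma sat_literal_cong:
  assumes "literal \<Psi>" "slab D s = slab D' s'"
  shows "sat D \<Psi> s \<longleftrightarrow> sat D' \<Psi> s'"
  using assms by induction auto

text \<open>The state \<open>s\<close> is arbitrary so that the induction hypotheses apply at every
  position of a path, without regard to reachability.\<close>

lemma sat_pctl_live:
  assumes labels: "\<And>\<omega> X. (\<And>i. \<omega> (Suc i) \<in> set_pmf (trn D (\<omega> i))) \<Longrightarrow> \<exists>i. slab D (\<omega> i) = X"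
    and "\<Phi> \<in> pctl_live"
  shows "sat D \<Phi> s"
  using assms(2)
proof (induction arbitrary: s)
  case (eventually \<Psi> q a)
  show ?case
  proof (cases "q = 0")
    case True
    then show ?thesis by simp
  next
    case False
    obtain E where "sat E (Prob GreaterEq q (Eventually a \<Psi>)) (init E)"
      using eventually.hyps(4) not_equiv_BotD by blast
    \<comment> \<open>A positive bound forces a nonempty set of paths, each passing through a state
      that satisfies \<open>\<Psi>\<close>; the label of such a state is the one to look for in
      \<open>D\<close>.\<close>
    then have "measure (path_measure E (init E)) {\<omega>. path_sat E (Eventually a \<Psi>) \<omega>} \<noteq> 0"
      using False eventually.hyps(2) by auto
    then have "{\<omega>. path_sat E (Eventually a \<Psi>) \<omega>} \<noteq> {}"
      by (metis measure_empty)
    then obtain t where t: "sat E \<Psi> t"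
      by (auto simp: Eventually_def)
    show ?thesis
    proof (rule sat_Prob_GreaterEqI)
      fix \<omega> assume "\<And>i. \<omega> (Suc i) \<in> set_pmf (trn D (\<omega> i))"
      then obtain i where "slab D (\<omega> i) = slab E t"
        using labels by blast
      then have "sat D \<Psi> (\<omega> i)"
        using sat_literal_cong[OF eventually.hyps(1)] t by blast
      then show "path_sat D (Eventually a \<Psi>) \<omega>"
        by (auto simp: Eventually_def)
    qed (use eventually.hyps in simp)
  qed
next
  \<comment> \<open>If \<open>\<Phi>\<^sub>2\<close> holds everywhere, position 0 witnesses the
    until part; if \<open>\<Phi>\<^sub>1\<close> does, the invariant part holds.\<close>
  case (weak_until \<Phi>\<^sub>1 \<Phi>\<^sub>2 q)
  then show ?case
    by (intro sat_Prob_GreaterEqI) (auto intro: exI[of _ 0])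
next
  case (next_step \<Phi> q)
  then show ?case
    by (intro sat_Prob_GreaterEqI) auto
next
  case (until \<Phi>\<^sub>1 \<Phi>\<^sub>2 q)
  then show ?case
    by (intro sat_Prob_GreaterEqI) (auto intro: exI[of _ 0])
qed auto

section \<open>Unfoldings are total trees\<close>

lemma unfolding_nodes_extend:
  assumes "\<pi> \<in> unfolding_nodes D"
  obtains t where "\<pi> @ [t] \<in> unfolding_nodes D"
  using set_pmf_not_empty[of "trn D (last \<pi>)"] unfolding_nodes.step[OF assms]
  by (metis ex_in_conv pmf_positive)

text \<open>Supports of distributions are nonempty, so unfoldings are total; this is pulled back
  along the isomorphism, which is onto and reflects prefixes.\<close>

lemma property_of_subset_total_pts:
  fixes \<Phi> :: "'ap state_formula"
  shows "property_of \<Phi> \<subseteq> total_pts"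
proof
  fix T assume "T \<in> property_of \<Phi>"
  then obtain D :: "'ap mc" and f where T: "is_pt T" and bij: "bij_betw f (nodes T) (unfolding_nodes D)"
    and pre: "\<forall>\<pi>\<in>nodes T. \<forall>\<pi>'\<in>nodes T. prefix (f \<pi>) (f \<pi>') \<longleftrightarrow> prefix \<pi> \<pi>'"
    by (auto simp: property_of_def pt_iso_def unfolding_pt_def)
  have "\<exists>\<pi>'\<in>nodes T. strict_prefix \<pi> \<pi>'" if \<pi>: "\<pi> \<in> nodes T" for \<pi>
  proof -
    obtain t where "f \<pi> @ [t] \<in> unfolding_nodes D"
      using bij \<pi> by (meson bij_betwE unfolding_nodes_extend)
    then obtain \<pi>' where \<pi>': "\<pi>' \<in> nodes T" "f \<pi>' = f \<pi> @ [t]"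
      using bij by (metis bij_betw_imp_surj_on imageE)
    have "prefix \<pi> \<pi>'"
      using pre \<pi> \<pi>' by (metis prefixI)
    moreover have "\<pi> \<noteq> \<pi>'"
      using \<pi>'(2) by auto
    ultimately show ?thesis
      using \<pi>' by (auto simp: strict_prefix_def)
  qed
  then show "T \<in> total_pts"
    using T by (simp add: total_pts_def)
qed

section \<open>Trees as Markov chains\<close>

text \<open>
  A tree is generated by a root and a successor distribution \<open>\<sigma>\<close> defined on all lists. The
  states of the associated chain are codes of lists; since \<open>\<sigma>\<close> is everywhere defined, states that
  are not codes of tree nodes behave like the others.
\<close>

inductive_set tree_nodes :: "nat \<Rightarrow> (nat list \<Rightarrow> nat list pmf) \<Rightarrow> nat list set" for r \<sigma> where
  root: "[r] \<in> tree_nodes r \<sigma>"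
| step: "\<pi> \<in> tree_nodes r \<sigma> \<Longrightarrow> \<pi>' \<in> set_pmf (\<sigma> \<pi>) \<Longrightarrow> \<pi>' \<in> tree_nodes r \<sigma>"

definition tree_pt :: "nat \<Rightarrow> (nat list \<Rightarrow> nat list pmf) \<Rightarrow> (nat list \<Rightarrow> 'ap set) \<Rightarrow> 'ap pt" where
  "tree_pt r \<sigma> l = \<lparr>nodes = tree_nodes r \<sigma>, lab = l,
     sdist = (\<lambda>\<pi>. if \<pi> \<in> tree_nodes r \<sigma> then Some (\<sigma> \<pi>) else None)\<rparr>"

lemma tree_pt_simps [simp]:
  "nodes (tree_pt r \<sigma> l) = tree_nodes r \<sigma>"
  "lab (tree_pt r \<sigma> l) = l"
  "sdist (tree_pt r \<sigma> l) \<pi> = (if \<pi> \<in> tree_nodes r \<sigma> then Some (\<sigma> \<pi>) else None)"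
  by (simp_all add: tree_pt_def)

definition tree_mc :: "nat \<Rightarrow> (nat list \<Rightarrow> nat list pmf) \<Rightarrow> (nat list \<Rightarrow> 'ap set) \<Rightarrow> 'ap mc" where
  "tree_mc r \<sigma> l = \<lparr>states = UNIV, trn = (\<lambda>s. map_pmf to_nat (\<sigma> (from_nat s))),
     slab = (\<lambda>s. l (from_nat s)), init = to_nat [r]\<rparr>"

text \<open>The isomorphism from a tree to the unfolding of its chain: a node goes to the sequence
  of states, that is of coded nodes, on the way to it from the root.\<close>

definition encode_prefixes :: "nat list \<Rightarrow> nat list" where
  "encode_prefixes \<pi> = map (\<lambda>i. to_nat (take (Suc i) \<pi>)) [0..<length \<pi>]"

lemma length_encode_prefixes [simp]: "length (encode_prefixes \<pi>) = length \<pi>"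
  by (simp add: encode_prefixes_def)

lemma encode_prefixes_snoc [simp]:
  "encode_prefixes (\<pi> @ [n]) = encode_prefixes \<pi> @ [to_nat (\<pi> @ [n])]"
  by (simp add: encode_prefixes_def)

lemma last_encode_prefixes: "\<pi> \<noteq> [] \<Longrightarrow> last (encode_prefixes \<pi>) = to_nat \<pi>"
  by (cases \<pi> rule: rev_cases) auto

lemma take_encode_prefixes: "take k (encode_prefixes \<pi>) = encode_prefixes (take k \<pi>)"
  by (rule nth_equalityI) (auto simp: encode_prefixes_def)

text \<open>The last entry codes the whole list; the empty list is told apart by its length.\<close>

lemma inj_encode_prefixes: "inj encode_prefixes"
proof (rule injI)
  fix \<pi> \<pi>' assume eq: "encode_prefixes \<pi> = encode_prefixes \<pi>'"
  then have len: "length \<pi> = length \<pi>'" by (metis length_encode_prefixes)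
  show "\<pi> = \<pi>'"
  proof (cases "\<pi> = []")
    case True
    with len show ?thesis by simp
  next
    case False
    with len have "\<pi>' \<noteq> []" by auto
    with False have "to_nat \<pi> = to_nat \<pi>'"
      using eq by (metis last_encode_prefixes)
    then show ?thesis by simp
  qed
qed

text \<open>Encoding commutes with truncation, so injectivity makes it reflect prefixes.\<close>

lemma prefix_encode_prefixes:
  "prefix (encode_prefixes \<pi>) (encode_prefixes \<pi>') \<longleftrightarrow> prefix \<pi> \<pi>'"
proof
  assume "prefix (encode_prefixes \<pi>) (encode_prefixes \<pi>')"
  then have "encode_prefixes \<pi> = encode_prefixes (take (length \<pi>) \<pi>')"
    by (metis append_eq_conv_conj length_encode_prefixes prefix_def take_encode_prefixes)
  then have "\<pi> = take (length \<pi>) \<pi>'"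
    by (rule injD[OF inj_encode_prefixes])
  then show "prefix \<pi> \<pi>'" by (metis take_is_prefix)
next
  assume "prefix \<pi> \<pi>'"
  then show "prefix (encode_prefixes \<pi>) (encode_prefixes \<pi>')"
    by (metis append_eq_conv_conj prefix_def take_encode_prefixes take_is_prefix)
qed

text \<open>Under this condition a list can be entered only from the list without its last entry, so
  parents are unique and the generated nodes form a tree.\<close>

locale tree_step =
  fixes \<sigma> :: "nat list \<Rightarrow> nat list pmf"
  assumes child: "\<pi>' \<in> set_pmf (\<sigma> \<pi>) \<Longrightarrow> \<exists>n. \<pi>' = \<pi> @ [n]"
begin

lemma Nil_notin_tree_nodes: "[] \<notin> tree_nodes r \<sigma>"
proof
  assume "[] \<in> tree_nodes r \<sigma>"
  then show False by cases (auto dest: child)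
qed

lemma snoc_in_tree_nodesD:
  assumes "\<pi> @ [n] \<in> tree_nodes r \<sigma>"
  shows "\<pi> = [] \<and> n = r \<or> \<pi> \<in> tree_nodes r \<sigma> \<and> \<pi> @ [n] \<in> set_pmf (\<sigma> \<pi>)"
  using assms by cases (auto dest: child)

lemma tree_nodes_prefix_closed:
  assumes "\<pi> \<in> tree_nodes r \<sigma>" "prefix \<pi>' \<pi>"
  shows "\<pi>' \<in> tree_nodes r \<sigma> \<union> {[]}"
  using assms
proof (induction \<pi> rule: rev_induct)
  case (snoc n \<pi>)
  then show ?case
    using snoc_in_tree_nodesD[OF snoc.prems(1)] by auto
qed simp

lemma edge_prob_tree_pt:
  "\<pi> \<in> tree_nodes r \<sigma> \<Longrightarrow> edge_prob (tree_pt r \<sigma> l) \<pi> \<pi>' = pmf (\<sigma> \<pi>) \<pi>'"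
  by (simp add: edge_prob_def)

lemma is_pt_tree_pt: "is_pt (tree_pt r \<sigma> l)"
proof -
  have "m = r" if "[m] \<in> tree_nodes r \<sigma>" for m
    using snoc_in_tree_nodesD[of "[]" m] that Nil_notin_tree_nodes by auto
  then have "\<forall>m n. [m] \<in> tree_nodes r \<sigma> \<longrightarrow> [n] \<in> tree_nodes r \<sigma> \<longrightarrow> m = n"
    by metis
  moreover have "edge_prob (tree_pt r \<sigma> l) \<pi> \<pi>' > 0 \<longleftrightarrow> (\<exists>n. \<pi>' = \<pi> @ [n]) \<and> \<pi>' \<in> tree_nodes r \<sigma>"
    if "\<pi> \<in> tree_nodes r \<sigma>" for \<pi> \<pi>'
  proof
    assume "edge_prob (tree_pt r \<sigma> l) \<pi> \<pi>' > 0"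
    then have "\<pi>' \<in> set_pmf (\<sigma> \<pi>)"
      using that by (simp add: edge_prob_tree_pt pmf_positive_iff)
    then show "(\<exists>n. \<pi>' = \<pi> @ [n]) \<and> \<pi>' \<in> tree_nodes r \<sigma>"
      using that child tree_nodes.step by metis
  next
    assume "(\<exists>n. \<pi>' = \<pi> @ [n]) \<and> \<pi>' \<in> tree_nodes r \<sigma>"
    \<comment> \<open>Inverting membership leaves the wanted edge or the root case, which would make
      \<open>\<pi>\<close> empty.\<close>
    then have "\<pi>' \<in> set_pmf (\<sigma> \<pi>)"
      using that snoc_in_tree_nodesD Nil_notin_tree_nodes by metis
    then show "edge_prob (tree_pt r \<sigma> l) \<pi> \<pi>' > 0"
      using that by (simp add: edge_prob_tree_pt pmf_positive_iff)
  qed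
  ultimately show ?thesis
    using Nil_notin_tree_nodes tree_nodes_prefix_closed tree_nodes.step
    unfolding is_pt_def by (simp add: subset_iff)
qed

text \<open>The last state of \<open>encode_prefixes \<pi>\<close> codes \<open>\<pi>\<close>, hence
  determines \<open>\<sigma> \<pi>\<close>; steps of the two inductive sets therefore
  correspond.\<close>

lemma unfolding_nodes_tree_mc:
  "unfolding_nodes (tree_mc r \<sigma> l) = encode_prefixes ` tree_nodes r \<sigma>"
proof (intro equalityI subsetI)
  fix p assume "p \<in> unfolding_nodes (tree_mc r \<sigma> l)"
  then show "p \<in> encode_prefixes ` tree_nodes r \<sigma>"
  proof induction
    case root
    have "[init (tree_mc r \<sigma> l)] = encode_prefixes [r]"
      by (simp add: tree_mc_def encode_prefixes_def)
    then show ?case using tree_nodes.root by blast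
  next
    case (step p t)
    then obtain \<pi> where \<pi>: "\<pi> \<in> tree_nodes r \<sigma>" "p = encode_prefixes \<pi>" by blast
    then have "last p = to_nat \<pi>"
      using Nil_notin_tree_nodes last_encode_prefixes by metis
    then have "t \<in> to_nat ` set_pmf (\<sigma> \<pi>)"
      using step.hyps(2) by (simp add: tree_mc_def pmf_positive_iff)
    then obtain \<pi>' where \<pi>': "\<pi>' \<in> set_pmf (\<sigma> \<pi>)" "t = to_nat \<pi>'" by blast
    then have "p @ [t] = encode_prefixes \<pi>'"
      using child \<pi>(2) by fastforce
    then show ?case using tree_nodes.step[OF \<pi>(1) \<pi>'(1)] by blast
  qed
next
  fix p assume "p \<in> encode_prefixes ` tree_nodes r \<sigma>"
  then obtain \<pi> where "\<pi> \<in> tree_nodes r \<sigma>" and p: "p = encode_prefixes \<pi>" by blast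
  from this(1) show "p \<in> unfolding_nodes (tree_mc r \<sigma> l)"
    unfolding p
  proof induction
    case root
    show ?case
      using unfolding_nodes.root[of "tree_mc r \<sigma> l"] by (simp add: tree_mc_def encode_prefixes_def)
  next
    case (step \<pi> \<pi>')
    have "last (encode_prefixes \<pi>) = to_nat \<pi>"
      using step.hyps(1) Nil_notin_tree_nodes last_encode_prefixes by metis
    then have "pmf (trn (tree_mc r \<sigma> l) (last (encode_prefixes \<pi>))) (to_nat \<pi>') > 0"
      using step.hyps(2) by (simp add: tree_mc_def pmf_positive_iff)
    from unfolding_nodes.step[OF step.IH this] show ?case
      using child[OF step.hyps(2)] by auto
  qed
qed

text \<open>For children \<open>\<pi>'\<close> of \<open>\<pi>\<close>, appending the code of
  \<open>\<pi>'\<close> yields its encoding, so the distribution in the unfolding is the image of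
  \<open>\<sigma> \<pi>\<close> under an injection.\<close>

lemma edge_prob_unfolding_tree_mc:
  assumes "\<pi> \<in> tree_nodes r \<sigma>"
  shows "edge_prob (unfolding_pt (tree_mc r \<sigma> l)) (encode_prefixes \<pi>) (encode_prefixes \<pi>') = pmf (\<sigma> \<pi>) \<pi>'"
proof -
  have "last (encode_prefixes \<pi>) = to_nat \<pi>"
    using assms Nil_notin_tree_nodes last_encode_prefixes by metis
  then have "map_pmf (\<lambda>t. encode_prefixes \<pi> @ [t]) (trn (tree_mc r \<sigma> l) (last (encode_prefixes \<pi>)))
      = map_pmf (\<lambda>\<pi>'. encode_prefixes \<pi> @ [to_nat \<pi>']) (\<sigma> \<pi>)"
    by (simp add: tree_mc_def map_pmf_comp)
  also have "\<dots> = map_pmf encode_prefixes (\<sigma> \<pi>)"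
    by (rule map_pmf_cong) (auto dest: child)
  finally show ?thesis
    using assms
    by (simp add: edge_prob_def unfolding_pt_def unfolding_nodes_tree_mc pmf_map_inj' inj_encode_prefixes)
qed

lemma pt_iso_tree_pt: "pt_iso (tree_pt r \<sigma> l) (unfolding_pt (tree_mc r \<sigma> l))"
  unfolding pt_iso_def
proof (intro exI[of _ encode_prefixes] conjI ballI)
  show "bij_betw encode_prefixes (nodes (tree_pt r \<sigma> l)) (nodes (unfolding_pt (tree_mc r \<sigma> l)))"
    by (simp add: unfolding_pt_def unfolding_nodes_tree_mc
        inj_on_imp_bij_betw inj_on_subset[OF inj_encode_prefixes])
  fix \<pi> assume "\<pi> \<in> nodes (tree_pt r \<sigma> l)"
  then have \<pi>: "\<pi> \<in> tree_nodes r \<sigma>" by simp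
  then have "\<pi> \<noteq> []" using Nil_notin_tree_nodes by metis
  then show "lab (unfolding_pt (tree_mc r \<sigma> l)) (encode_prefixes \<pi>) = lab (tree_pt r \<sigma> l) \<pi>"
    by (simp add: unfolding_pt_def tree_mc_def last_encode_prefixes)
  fix \<pi>'
  show "edge_prob (unfolding_pt (tree_mc r \<sigma> l)) (encode_prefixes \<pi>) (encode_prefixes \<pi>') =
      edge_prob (tree_pt r \<sigma> l) \<pi> \<pi>'"
    using \<pi> by (simp add: edge_prob_unfolding_tree_mc edge_prob_tree_pt)
qed (rule prefix_encode_prefixes)

lemma is_mc_tree_mc: "is_mc (tree_mc r \<sigma> l)"
  by (simp add: is_mc_def tree_mc_def)

text \<open>Makes a path from any state, coding a tree node or not, run through all depths from its
  starting depth on.\<close>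

lemma length_along_path:
  assumes "\<And>i. \<omega> (Suc i) \<in> set_pmf (trn (tree_mc r \<sigma> l) (\<omega> i))"
  shows "length (from_nat (\<omega> i) :: nat list) = length (from_nat (\<omega> 0) :: nat list) + i"
proof (induction i)
  case (Suc i)
  obtain \<pi> where "\<pi> \<in> set_pmf (\<sigma> (from_nat (\<omega> i)))" "\<omega> (Suc i) = to_nat \<pi>"
    using assms[of i] by (auto simp: tree_mc_def)
  then show ?case using child Suc by fastforce
qed simp

end

section \<open>Extending a finite-depth tree\<close>

text \<open>For a tree \<open>T\<close>, the \<open>None\<close> case covers its leaves and all
  lists outside it; there a non-branching chain starts or continues.\<close>

definition extend_step :: "'ap pt \<Rightarrow> nat list \<Rightarrow> nat list pmf" where
  "extend_step T \<pi> = (case sdist T \<pi> of None \<Rightarrow> return_pmf (\<pi> @ [0]) | Some \<mu> \<Rightarrow> \<mu>)"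

definition extend_lab :: "'ap pt \<Rightarrow> (nat \<Rightarrow> 'ap set) \<Rightarrow> nat list \<Rightarrow> 'ap set" where
  "extend_lab T g \<pi> = (if \<pi> \<in> nodes T then lab T \<pi> else g (length \<pi>))"

lemma tree_step_extend_step:
  assumes "is_pt T"
  shows "tree_step (extend_step T)"
proof
  fix \<pi> \<pi>' assume \<pi>': "\<pi>' \<in> set_pmf (extend_step T \<pi>)"
  show "\<exists>n. \<pi>' = \<pi> @ [n]"
  proof (cases "sdist T \<pi>")
    case None
    then show ?thesis using \<pi>' by (simp add: extend_step_def)
  next
    case (Some \<mu>)
    then have "\<pi> \<in> nodes T" "edge_prob T \<pi> \<pi>' > 0"
      using assms \<pi>' by (auto simp: is_pt_def edge_prob_def extend_step_def pmf_positive_iff)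
    then show ?thesis using assms by (auto simp: is_pt_def)
  qed
qed

lemma is_pt_edge_prob_pos:
  assumes "is_pt T" "\<pi> \<in> nodes T" "\<pi> @ [n] \<in> nodes T"
  shows "edge_prob T \<pi> (\<pi> @ [n]) > 0"
  using assms unfolding is_pt_def by blast

text \<open>Every node is reached from the root along edges of positive probability, and
  \<open>extend_step\<close> keeps these.\<close>

lemma nodes_subset_tree_nodes:
  assumes T: "is_pt T" and r: "\<And>n. [n] \<in> nodes T \<Longrightarrow> n = r"
  shows "nodes T \<subseteq> tree_nodes r (extend_step T)"
proof
  fix \<pi> assume "\<pi> \<in> nodes T"
  then show "\<pi> \<in> tree_nodes r (extend_step T)"
  proof (induction \<pi> rule: rev_induct)
    case Nil
    then show ?case using T by (simp add: is_pt_def)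
  next
    case (snoc n \<pi>)
    show ?case
    proof (cases "\<pi> = []")
      case True
      then show ?thesis using snoc.prems r tree_nodes.root by auto
    next
      case False
      have "\<pi> \<in> nodes T \<union> {[]}"
        using T snoc.prems unfolding is_pt_def by (meson prefixI)
      then have \<pi>: "\<pi> \<in> nodes T" using False by simp
      then have "edge_prob T \<pi> (\<pi> @ [n]) > 0"
        using is_pt_edge_prob_pos T snoc.prems by blast
      then have "\<pi> @ [n] \<in> set_pmf (extend_step T \<pi>)"
        by (auto simp: edge_prob_def extend_step_def pmf_positive_iff split: option.splits)
      then show ?thesis using snoc.IH[OF \<pi>] tree_nodes.step by blast
    qed
  qed
qed

lemma pt_prefix_extension:
  assumes T: "is_pt T" and r: "\<And>n. [n] \<in> nodes T \<Longrightarrow> n = r"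
  shows "pt_prefix T (tree_pt r (extend_step T) (extend_lab T g))"
  unfolding pt_prefix_def
proof (intro conjI ballI)
  interpret tree_step "extend_step T" by (rule tree_step_extend_step[OF T])
  show "nodes T \<subseteq> nodes (tree_pt r (extend_step T) (extend_lab T g))"
    using nodes_subset_tree_nodes[OF assms] by simp
  fix \<pi> assume \<pi>: "\<pi> \<in> nodes T"
  show "lab (tree_pt r (extend_step T) (extend_lab T g)) \<pi> = lab T \<pi>"
    using \<pi> by (simp add: extend_lab_def)
  fix \<pi>' assume \<pi>': "\<pi>' \<in> nodes T"
  have "pmf (extend_step T \<pi>) \<pi>' = edge_prob T \<pi> \<pi>'"
  proof (cases "sdist T \<pi>")
    case None
    \<comment> \<open>The child added below a leaf is new: were it in \<open>T\<close>, the leaf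
      would have an edge of positive probability to it.\<close>
    then have "\<pi>' \<noteq> \<pi> @ [0]"
      using is_pt_edge_prob_pos[OF T \<pi>] \<pi>' by (auto simp: edge_prob_def)
    with None show ?thesis by (simp add: extend_step_def edge_prob_def)
  qed (simp add: extend_step_def edge_prob_def)
  then show "edge_prob (tree_pt r (extend_step T) (extend_lab T g)) \<pi> \<pi>' = edge_prob T \<pi> \<pi>'"
    using nodes_subset_tree_nodes[OF assms] \<pi> by (subst edge_prob_tree_pt) auto
qed

text \<open>Decode \<open>n\<close> as a pair and use only the first component: each value recurs
  for every second component \<open>m\<close>, at an index that is at least
  \<open>m\<close>.\<close>

lemma ex_recurrent_enumeration: "\<exists>g :: nat \<Rightarrow> 'a::finite. \<forall>x m. \<exists>n\<ge>m. g n = x"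
proof -
  have "\<exists>n\<ge>m. from_nat_into UNIV (fst (prod_decode n)) = x" for x :: 'a and m
  proof -
    obtain i where "from_nat_into UNIV i = x"
      using from_nat_into_surj[of "UNIV :: 'a set" x] by (auto simp: countable_finite)
    then show ?thesis
      by (intro exI[of _ "prod_encode (i, m)"]) (simp add: le_prod_encode_2)
  qed
  then show ?thesis
    by (intro exI[of _ "\<lambda>n. from_nat_into UNIV (fst (prod_decode n))"]) blast
qed

theorem theorem6:
  fixes \<Phi> :: "'ap::finite state_formula"
  assumes "\<Phi> \<in> pctl_live"
  shows "liveness (property_of \<Phi>)"
  unfolding liveness_def
proof (intro conjI ballI)
  show "property_of \<Phi> \<subseteq> total_pts" by (rule property_of_subset_total_pts)
  fix T :: "'ap pt" assume "T \<in> finite_depth_pts"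
  then obtain k where T: "is_pt T" and k: "\<And>\<pi>. \<pi> \<in> nodes T \<Longrightarrow> length \<pi> \<le> k"
    by (auto simp: finite_depth_pts_def)
  interpret tree_step "extend_step T" by (rule tree_step_extend_step[OF T])
  \<comment> \<open>If \<open>T\<close> has no nodes, any \<open>r\<close> will do.\<close>
  obtain r where r: "\<And>n. [n] \<in> nodes T \<Longrightarrow> n = r"
    using T unfolding is_pt_def by metis
  obtain g :: "nat \<Rightarrow> 'ap set" where g: "\<And>X m. \<exists>n\<ge>m. g n = X"
    using ex_recurrent_enumeration by metis
  let ?D = "tree_mc r (extend_step T) (extend_lab T g)"
  have "sat ?D \<Phi> (init ?D)"
  proof (rule sat_pctl_live[OF _ assms])
    fix \<omega> X assume \<omega>: "\<And>i. \<omega> (Suc i) \<in> set_pmf (trn ?D (\<omega> i))"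
    let ?len = "\<lambda>i. length (from_nat (\<omega> i) :: nat list)"
    \<comment> \<open>A depth past \<open>k\<close> lies outside \<open>T\<close>, where
      \<open>g\<close> gives the label; a depth past the start of the path is attained, and the
      subtraction below does not truncate.\<close>
    obtain n where n: "n \<ge> ?len 0 + Suc k" "g n = X" using g by blast
    have "?len (n - ?len 0) = n"
      using length_along_path[of \<omega> r "extend_lab T g" "n - ?len 0", OF \<omega>] n(1) by simp
    moreover from this have "from_nat (\<omega> (n - ?len 0)) \<notin> nodes T"
      using k n(1) by fastforce
    ultimately have "slab ?D (\<omega> (n - ?len 0)) = X"
      using n(2) by (simp add: tree_mc_def extend_lab_def)
    then show "\<exists>i. slab ?D (\<omega> i) = X" by blast
  qed
  then have "tree_pt r (extend_step T) (extend_lab T g) \<in> property_of \<Phi>"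
    using is_pt_tree_pt is_mc_tree_mc pt_iso_tree_pt unfolding property_of_def mc_sat_def by blast
  then show "\<exists>T\<^sub>2\<in>property_of \<Phi>. pt_prefix T T\<^sub>2"
    using pt_prefix_extension[OF T r] by blast
qed

end
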